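(* Let $$I_p:=\left\{(\mu,\gamma)\in\mathbb{R}^2:\ \mu>0,\ 0<\gamma<\tfrac23(\sqrt{1+3\mu}-1)\right\}.$$ For $(\mu,\gamma)\in\mathbb{R}^2$ let $u_r$ and $p$ be the radial velocity and the pressure on $\mathbb{S}^2$, as functions of $x=\cos\theta$, of the axisymmetric no-swirl solution with parameters $(\mu,\gamma)$ (see context). For any $(\mu,\gamma)\in I_p$, $u_r|_{x=1}>0$ and $p'|_{x=1}<0$. For any $(\mu,\gamma)\in\mathbb{R}^2\setminus I_p$, either $u_r|_{x=1}\le0$, or there exists $\delta>0$ such that $p(x)<p(1)$ in $(1-\delta,1)$.
   Context: The stationary incompressible Navier-Stokes equations in $\mathbb{R}^3$ are $-\Delta u+u\cdot\nabla u+\nabla p=0$, $\operatorname{div}u=0$. Consider $(-1)$-homogeneous axisymmetric no-swirl $u$ with $(-2)$-homogeneous $p$; on $\mathbb{S}^2$ set $x=\cos\theta$ ($\theta$ the angle from the positive $x_3$-axis, $x=1$ the north pole), $U_\theta=u_\theta\sin\theta$, $'=d/dx$. For each $(\mu,\gamma)\in\mathbb{R}^2$ let $U_\theta=U_\theta(\mu,\gamma;\cdot)$ be the unique smooth solution, on its maximal interval of existence $(\delta^*,1)$ with $-1\le\delta^*<1$, of $$(1-x^2)U_\theta'+2xU_\theta+\tfrac12U_\theta^2=\mu(1-x)^2,\qquad\lim_{x\to1^-}U_\theta(x)=0,\quad\lim_{x\to1^-}U_\theta'(x)=\gamma.$$ The corresponding solution of the Navier-Stokes equations near the north pole has, on $\mathbb{S}^2$,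 $u_r=U_\theta'$, $u_\theta=U_\theta/\sin\theta$, $u_\phi=0$, and pressure $$p=\tfrac12\left(-(1-x^2)U_\theta'''+2xU_\theta''-(U_\theta')^2-U_\theta U_\theta''-\frac{U_\theta^2}{1-x^2}\right).$$ Values of $u_r,p,p'$ at $x=1$ are understood as limits as $x\to1^-$. *)

theory Defs
  imports "HOL-Analysis.Analysis"
begin

definition smooth_on_open :: "real set \<Rightarrow> (real \<Rightarrow> real) \<Rightarrow> bool" where
  "smooth_on_open S f \<longleftrightarrow> (\<forall>n. \<forall>x\<in>S. ((deriv ^^ n) f) differentiable at x)"

text \<open>
  A function on the interval (a, 1) is represented by a total function whose values outside
  (a, 1) are irrelevant.
\<close>

definition north_solution :: "real \<Rightarrow> real \<Rightarrow> real \<Rightarrow> (real \<Rightarrow> real) \<Rightarrow> bool" where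
  "north_solution \<mu> \<gamma> a U \<longleftrightarrow>
     - 1 \<le> a \<and> a < 1 \<and> smooth_on_open {a<..<1} U \<and>
     (\<forall>x\<in>{a<..<1}. (1 - x\<^sup>2) * deriv U x + 2 * x * U x + 1/2 * (U x)\<^sup>2 = \<mu> * (1 - x)\<^sup>2) \<and>
     (U \<longlongrightarrow> 0) (at_left 1) \<and> (deriv U \<longlongrightarrow> \<gamma>) (at_left 1)"

definition maximal_north_solution :: "real \<Rightarrow> real \<Rightarrow> real \<Rightarrow> (real \<Rightarrow> real) \<Rightarrow> bool" where
  "maximal_north_solution \<mu> \<gamma> a U \<longleftrightarrow>
     north_solution \<mu> \<gamma> a U \<and>
     \<not> (\<exists>b V. b < a \<and> north_solution \<mu> \<gamma> b V \<and> (\<forall>x\<in>{a<..<1}. V x = U x))"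

definition radial_velocity :: "(real \<Rightarrow> real) \<Rightarrow> real \<Rightarrow> real" where
  "radial_velocity U = deriv U"

definition pressure :: "(real \<Rightarrow> real) \<Rightarrow> real \<Rightarrow> real" where
  "pressure U x =
     1/2 * (- (1 - x\<^sup>2) * (deriv ^^ 3) U x + 2 * x * (deriv ^^ 2) U x - (deriv U x)\<^sup>2
            - U x * (deriv ^^ 2) U x - (U x)\<^sup>2 / (1 - x\<^sup>2))"

definition I_p :: "(real \<times> real) set" where
  "I_p = {(\<mu>, \<gamma>). \<mu> > 0 \<and> 0 < \<gamma> \<and> \<gamma> < 2/3 * (sqrt (1 + 3 * \<mu>) - 1)}"

end

theory Submission
  imports Defs
begin

text \<open>
  Differentiating the equation twice reduces the pressure to
  \<open>p = U' - \<mu> - U\<^sup>2 / (2 (1 - x\<^sup>2))\<close>.  The substitution \<open>U = (x - 1) h\<close> removes the singularity of the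
  equation at \<open>x = 1\<close>: it becomes the Riccati equation \<open>(1 + x) h' = h\<^sup>2/2 + h - \<mu>\<close> with \<open>h(1) = \<gamma>\<close>.
  Hence \<open>p'(1) = 3\<gamma>\<^sup>2/4 + \<gamma> - \<mu>\<close>, which for \<open>\<gamma> > 0\<close> is negative exactly on \<open>I\<^sub>p\<close>.  In the
  borderline case \<open>p'(1) = 0\<close> one has \<open>p''(1) = - 5\<gamma>\<^sup>3/16 - \<gamma>\<^sup>2/4 < 0\<close>, so that still \<open>p' > 0\<close>
  to the left of \<open>1\<close>.
\<close>

section \<open>Calculus on open intervals\<close>

lemma less_left_limit:
  fixes f f' :: "real \<Rightarrow> real"
  assumes deriv: "\<And>x. x \<in> {a<..<b} \<Longrightarrow> (f has_real_derivative f' x) (at x)"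
    and pos: "\<And>x. x \<in> {a<..<b} \<Longrightarrow> f' x > 0"
    and lim: "(f \<longlongrightarrow> l) (at_left b)"
    and x: "x \<in> {a<..<b}"
  shows "f x < l"
proof -
  have mono: "f u < f v" if "a < u" "u < v" "v < b" for u v
  proof (rule DERIV_pos_imp_increasing[OF \<open>u < v\<close>])
    fix y assume "u \<le> y" "y \<le> v"
    with that have "y \<in> {a<..<b}" by simp
    with deriv pos show "\<exists>d. (f has_real_derivative d) (at y) \<and> 0 < d" by blast
  qed
  \<comment> \<open>Passing to the limit yields only the weak bound \<open>f m \<le> l\<close>;
    strictness is recovered from \<open>f x < f m\<close> at an intermediate point.\<close>
  define m where "m = (x + b) / 2"
  have m: "x < m" "m < b" using x by (auto simp: m_def)
  have "eventually (\<lambda>y. f m \<le> f y) (at_left b)"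
    using eventually_at_left_real[OF m(2)]
  proof eventually_elim
    case (elim y)
    with m x have "f m < f y" by (intro mono) auto
    then show ?case by simp
  qed
  then have "f m \<le> l"
    by (rule tendsto_lowerbound[OF lim]) simp
  moreover have "f x < f m"
    using m x by (intro mono) auto
  ultimately show ?thesis by linarith
qed

text \<open>Allows an equation valid on a whole interval to be differentiated: moved to one side, it
  makes every derivative computed by the calculus rules vanish as well.\<close>

lemma has_derivative_zero_on_open_interval:
  fixes f :: "real \<Rightarrow> real"
  assumes "(f has_real_derivative d) (at x)" "x \<in> {a<..<b}" "\<And>y. y \<in> {a<..<b} \<Longrightarrow> f y = 0"
  shows "d = 0"
proof -
  have "(f has_real_derivative 0) (at x)"
    by (rule has_field_derivative_transform_within_open[of "\<lambda>_. 0" _ _ "{a<..<b}"])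
       (use assms in auto)
  with assms(1) show ?thesis by (rule DERIV_unique)
qed

lemma smooth_on_open_has_derivative:
  assumes "smooth_on_open S f" "x \<in> S"
  shows "((deriv ^^ n) f has_real_derivative (deriv ^^ Suc n) f x) (at x)"
  using assms unfolding smooth_on_open_def
  by (auto simp: DERIV_deriv_iff_real_differentiable)

text \<open>The second derivative of the equation says that all terms of the bracket in
  \<open>pressure\<close> except the last add up to \<open>2 * (deriv U x - \<mu>)\<close>.\<close>

lemma pressure_eq:
  assumes "north_solution \<mu> \<gamma> a U" and x: "x \<in> {a<..<1}"
  shows "pressure U x = deriv U x - \<mu> - (U x)\<^sup>2 / (2 * (1 - x\<^sup>2))"
proof -
  let ?S = "{a<..<1}"
  let ?D = "\<lambda>n. (deriv ^^ n) U"
  have smooth: "smooth_on_open ?S U"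
    and ode: "\<And>y. y \<in> ?S \<Longrightarrow> (1 - y\<^sup>2) * ?D 1 y + 2 * y * U y + 1/2 * (U y)\<^sup>2 - \<mu> * (1 - y)\<^sup>2 = 0"
    using assms by (auto simp: north_solution_def)
  note der [derivative_intros] =
    smooth_on_open_has_derivative[OF smooth, of _ 0, simplified]
    smooth_on_open_has_derivative[OF smooth, of _ 1, simplified]
    smooth_on_open_has_derivative[OF smooth, of _ "Suc (Suc 0)", simplified]
  have ode': "(1 - y\<^sup>2) * ?D 2 y + 2 * U y + U y * ?D 1 y + 2 * \<mu> * (1 - y) = 0" if y: "y \<in> ?S" for y
  proof (rule has_derivative_zero_on_open_interval[OF _ y ode])
    show "((\<lambda>y. (1 - y\<^sup>2) * ?D 1 y + 2 * y * U y + 1/2 * (U y)\<^sup>2 - \<mu> * (1 - y)\<^sup>2)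
      has_real_derivative (1 - y\<^sup>2) * ?D 2 y + 2 * U y + U y * ?D 1 y + 2 * \<mu> * (1 - y)) (at y)"
      using y by (auto intro!: derivative_eq_intros simp: algebra_simps numeral_2_eq_2)
  qed
  have ode'': "(1 - x\<^sup>2) * ?D 3 x - 2 * x * ?D 2 x + 2 * ?D 1 x + (?D 1 x)\<^sup>2 + U x * ?D 2 x - 2 * \<mu> = 0"
  proof (rule has_derivative_zero_on_open_interval[OF _ x ode'])
    show "((\<lambda>y. (1 - y\<^sup>2) * ?D 2 y + 2 * U y + U y * ?D 1 y + 2 * \<mu> * (1 - y)) has_real_derivative
       (1 - x\<^sup>2) * ?D 3 x - 2 * x * ?D 2 x + 2 * ?D 1 x + (?D 1 x)\<^sup>2 + U x * ?D 2 x - 2 * \<mu>) (at x)"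
      using x by (auto intro!: derivative_eq_intros simp: algebra_simps eval_nat_numeral)
  qed
  \<comment> \<open>With the factor 1/2 split off, the quotient is the same atom as in
    \<open>pressure\<close>, and the remaining claim is linear in it.\<close>
  moreover have "(U x)\<^sup>2 / (2 * (1 - x\<^sup>2)) = (U x)\<^sup>2 / (1 - x\<^sup>2) / 2"
    by simp
  ultimately show ?thesis
    unfolding pressure_def by (simp only:) (simp add: algebra_simps)
qed

section \<open>The Riccati equation for the slope\<close>

context
  fixes \<mu> \<gamma> a :: real and U :: "real \<Rightarrow> real"
  assumes sol: "north_solution \<mu> \<gamma> a U"
begin

text \<open>This is the function \<open>h\<close> of the substitution: the difference quotient of
  \<open>U\<close> at 1, with the value 0 for \<open>U\<close> there.\<close>

definition "slope x = U x / (x - 1)"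

text \<open>The Riccati equation solved for \<open>h'\<close>. Being a formula in
  \<open>slope\<close> rather than \<open>deriv slope\<close>, it inherits its limit at 1 from
  \<open>slope\<close>.\<close>

definition "slope_deriv x = ((slope x)\<^sup>2 / 2 + slope x - \<mu>) / (1 + x)"

text \<open>Obtained from \<open>pressure_eq_slope\<close> by differentiating and eliminating
  \<open>h'' = h h' / (1 + x)\<close>. The last term collects two equal contributions, one from
  \<open>(x - 1) h''\<close> and one from the term quadratic in \<open>h\<close>.\<close>

definition "pressure_deriv x =
  2 * slope_deriv x + (slope x)\<^sup>2 / (1 + x)\<^sup>2 - 2 * (1 - x) * slope x * slope_deriv x / (1 + x)"

definition "slope_deriv2 x = slope x * slope_deriv x / (1 + x)"

definition "pressure_deriv2 x =
  2 * slope_deriv2 x + 2 * slope x * slope_deriv x / (1 + x)\<^sup>2 - 2 * (slope x)\<^sup>2 / (1 + x)^3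
  - 2 * (1 - x) * ((slope_deriv x)\<^sup>2 + slope x * slope_deriv2 x) / (1 + x)
  + 2 * slope x * slope_deriv x / (1 + x) + 2 * (1 - x) * slope x * slope_deriv x / (1 + x)\<^sup>2"

lemma a_bounds: "- 1 \<le> a" "a < 1"
  using sol by (auto simp: north_solution_def)

lemma deriv_U:
  assumes "x \<in> {a<..<1}"
  shows "(U has_real_derivative deriv U x) (at x)"
  using smooth_on_open_has_derivative[of "{a<..<1}" U x 0] sol assms
  by (auto simp: north_solution_def)

lemma U_eq_slope: "x \<noteq> 1 \<Longrightarrow> U x = (x - 1) * slope x"
  by (simp add: slope_def)

text \<open>It has the form of the product rule for \<open>U = (x - 1) h\<close>, but comes from the
  equation by algebra: a common factor \<open>x - 1\<close> cancels. Thus it is available for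
  proving that \<open>slope_deriv\<close> is the derivative of \<open>slope\<close>.\<close>

lemma deriv_U_eq_slope:
  assumes x: "x \<in> {a<..<1}"
  shows "deriv U x = slope x + (x - 1) * slope_deriv x"
proof -
  have nz: "1 + x \<noteq> 0" "x - 1 \<noteq> 0" using x a_bounds by auto
  have "(1 - x\<^sup>2) * deriv U x + 2 * x * ((x - 1) * slope x) + 1/2 * ((x - 1) * slope x)\<^sup>2
      = \<mu> * (1 - x)\<^sup>2"
  proof -
    have "(1 - x\<^sup>2) * deriv U x + 2 * x * U x + 1/2 * (U x)\<^sup>2 = \<mu> * (1 - x)\<^sup>2"
      using sol x by (auto simp: north_solution_def)
    then show ?thesis
      using U_eq_slope[of x] nz by simp
  qed
  \<comment> \<open>The difference of the two sides wanted below is the residual of the equation,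
    which vanishes.\<close>
  moreover have "(x - 1) * (2 * x * slope x + (x - 1) * (slope x)\<^sup>2 / 2 - \<mu> * (x - 1))
        - (x - 1) * ((1 + x) * deriv U x)
      = (1 - x\<^sup>2) * deriv U x + 2 * x * ((x - 1) * slope x) + 1/2 * ((x - 1) * slope x)\<^sup>2
        - \<mu> * (1 - x)\<^sup>2"
    by (simp add: power2_eq_square field_simps)
  ultimately have "(x - 1) * ((1 + x) * deriv U x) =
      (x - 1) * (2 * x * slope x + (x - 1) * (slope x)\<^sup>2 / 2 - \<mu> * (x - 1))"
    by (simp only: diff_self right_minus_eq)
  then have "(1 + x) * deriv U x = 2 * x * slope x + (x - 1) * (slope x)\<^sup>2 / 2 - \<mu> * (x - 1)"
    using nz by simp
  also have "\<dots> = (1 + x) * (slope x + (x - 1) * slope_deriv x)"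
    using nz by (simp add: slope_deriv_def field_simps)
  finally show ?thesis using nz by simp
qed

text \<open>By \<open>deriv_U_eq_slope\<close> the numerator in the quotient rule is exactly
  \<open>(x - 1)\<^sup>2 h'\<close>.\<close>

lemma DERIV_slope:
  assumes x: "x \<in> {a<..<1}"
  shows "(slope has_real_derivative slope_deriv x) (at x)"
proof -
  have nz: "x - 1 \<noteq> 0" using x by auto
  have "((\<lambda>y. U y / (y - 1)) has_real_derivative (deriv U x * (x - 1) - U x) / (x - 1)\<^sup>2) (at x)"
    using nz by (auto intro!: derivative_eq_intros deriv_U x simp: power2_eq_square)
  also have "deriv U x * (x - 1) - U x = slope_deriv x * (x - 1)\<^sup>2"
    using nz unfolding deriv_U_eq_slope[OF x]
    by (subst U_eq_slope) (auto simp: power2_eq_square algebra_simps)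
  also have "slope_deriv x * (x - 1)\<^sup>2 / (x - 1)\<^sup>2 = slope_deriv x"
    using nz by simp
  finally show ?thesis unfolding slope_def[abs_def] .
qed

text \<open>In the differentiated Riccati equation \<open>(1 + x) h'' + h' = h h' + h'\<close> the
  two single \<open>h'\<close> cancel.\<close>

lemma DERIV_slope_deriv:
  assumes x: "x \<in> {a<..<1}"
  shows "(slope_deriv has_real_derivative slope_deriv2 x) (at x)"
proof -
  have nz: "1 + x \<noteq> 0" using x a_bounds by auto
  then have eq: "(slope x)\<^sup>2 / 2 + slope x - \<mu> = (1 + x) * slope_deriv x"
    by (simp add: slope_deriv_def)
  have "((\<lambda>y. ((slope y)\<^sup>2 / 2 + slope y - \<mu>) / (1 + y)) has_real_derivative
      ((slope x * slope_deriv x + slope_deriv x) * (1 + x) - ((slope x)\<^sup>2 / 2 + slope x - \<mu>))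
        / (1 + x)\<^sup>2) (at x)"
    using nz by (auto intro!: derivative_eq_intros DERIV_slope x simp: power2_eq_square)
  also have "(slope x * slope_deriv x + slope_deriv x) * (1 + x) - ((slope x)\<^sup>2 / 2 + slope x - \<mu>)
      = slope x * slope_deriv x * (1 + x)"
    unfolding eq by (simp add: algebra_simps)
  also have "slope x * slope_deriv x * (1 + x) / (1 + x)\<^sup>2 = slope_deriv2 x"
    using nz by (simp add: slope_deriv2_def power2_eq_square)
  finally show ?thesis unfolding slope_deriv_def[abs_def] .
qed

text \<open>In terms of \<open>h\<close> the quotient \<open>U\<^sup>2 / (1 - x\<^sup>2)\<close>
  loses the factor \<open>1 - x\<close> of its denominator, so that every term has a limit at
  1.\<close>

lemma pressure_eq_slope:
  assumes x: "x \<in> {a<..<1}"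
  shows "pressure U x =
    slope x + (x - 1) * slope_deriv x - \<mu> - (1 - x) * (slope x)\<^sup>2 / (2 * (1 + x))"
proof -
  have nz: "1 + x \<noteq> 0" "x - 1 \<noteq> 0" "1 - x \<noteq> 0" using x a_bounds by auto
  have "(U x)\<^sup>2 / (2 * (1 - x\<^sup>2)) = ((1 - x) * ((1 - x) * (slope x)\<^sup>2)) / ((1 - x) * (2 * (1 + x)))"
    using U_eq_slope[of x] nz by (simp only:) (simp add: power2_eq_square algebra_simps)
  also have "\<dots> = (1 - x) * (slope x)\<^sup>2 / (2 * (1 + x))"
    using nz by simp
  finally show ?thesis
    by (simp add: pressure_eq[OF sol x] deriv_U_eq_slope[OF x])
qed

lemma DERIV_pressure:
  assumes x: "x \<in> {a<..<1}"
  shows "(pressure U has_real_derivative pressure_deriv x) (at x)"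
proof (rule has_field_derivative_transform_within_open[where S = "{a<..<1}"])
  \<comment> \<open>Naming the only reciprocal makes all derivatives below polynomial in
    \<open>r\<close>, so that they can be compared by ring identities.\<close>
  define r :: "real \<Rightarrow> real" where "r y = inverse (1 + y)" for y
  have nz: "1 + x \<noteq> 0" using x a_bounds by auto
  then have "(r has_real_derivative - (r x)\<^sup>2) (at x)"
    unfolding r_def by (auto intro!: derivative_eq_intros simp: power2_eq_square)
  then have "((\<lambda>y. (1 - y) * (slope y)\<^sup>2 * r y) has_real_derivative
      2 * (1 - x) * slope x * slope_deriv x * r x - (slope x)\<^sup>2 * r x * (1 + (1 - x) * r x)) (at x)"
    by (auto intro!: derivative_eq_intros DERIV_slope x simp: power2_eq_square algebra_simps)
  \<comment> \<open>This is \<open>(1 + x) * r x = 1\<close> rearranged; it reflects that (1 - x)/(1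
    + x) has derivative -2/(1 + x)^2.\<close>
  also have "1 + (1 - x) * r x = 2 * r x"
    using nz by (simp add: r_def field_simps)
  finally have q: "((\<lambda>y. (1 - y) * (slope y)\<^sup>2 * r y) has_real_derivative
      2 * (1 - x) * slope x * slope_deriv x * r x - (slope x)\<^sup>2 * r x * (2 * r x)) (at x)" .
  \<comment> \<open>\<open>d\<close> is half the derivative in \<open>q\<close>; the factor 2
    cancels against the division by 2 in the pressure.\<close>
  define d where "d = (1 - x) * slope x * slope_deriv x * r x - (slope x)\<^sup>2 * (r x)\<^sup>2"
  have "2 * (1 - x) * slope x * slope_deriv x * r x - (slope x)\<^sup>2 * r x * (2 * r x) = d * 2"
    by (simp add: d_def power2_eq_square algebra_simps)
  note q = q[unfolded this]
  have "((\<lambda>y. slope y + (y - 1) * slope_deriv y - \<mu> - (1 - y) * (slope y)\<^sup>2 * r y / 2)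
      has_real_derivative slope_deriv x + (slope_deriv x + (x - 1) * slope_deriv2 x) - d) (at x)"
    by (rule DERIV_cong, (rule q DERIV_cdivide derivative_intros DERIV_slope DERIV_slope_deriv x)+) simp
  also have "slope_deriv x + (slope_deriv x + (x - 1) * slope_deriv2 x) - d = pressure_deriv x"
    unfolding d_def slope_deriv2_def pressure_deriv_def divide_inverse power_inverse[symmetric]
      r_def[symmetric]
    by algebra
  finally show "((\<lambda>y. slope y + (y - 1) * slope_deriv y - \<mu> - (1 - y) * (slope y)\<^sup>2 * r y / 2)
    has_real_derivative pressure_deriv x) (at x)" .
  show "slope y + (y - 1) * slope_deriv y - \<mu> - (1 - y) * (slope y)\<^sup>2 * r y / 2 = pressure U y"
    if "y \<in> {a<..<1}" for y
    unfolding pressure_eq_slope[OF that] r_def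
    by (simp only: divide_inverse inverse_mult_distrib mult_ac)
qed (use x in auto)

lemma DERIV_pressure_deriv:
  assumes x: "x \<in> {a<..<1}"
  shows "(pressure_deriv has_real_derivative pressure_deriv2 x) (at x)"
proof -
  define r :: "real \<Rightarrow> real" where "r y = inverse (1 + y)" for y
  have "(r has_real_derivative - (r x)\<^sup>2) (at x)"
    unfolding r_def using x a_bounds
    by (auto intro!: derivative_eq_intros simp: power2_eq_square)
  then have "((\<lambda>y. 2 * slope_deriv y + (slope y)\<^sup>2 * (r y)\<^sup>2
        - 2 * (1 - y) * slope y * slope_deriv y * r y) has_real_derivative
      2 * slope_deriv2 x + 2 * slope x * slope_deriv x * (r x)\<^sup>2 - 2 * (slope x)\<^sup>2 * (r x)^3
      - 2 * (1 - x) * ((slope_deriv x)\<^sup>2 + slope x * slope_deriv2 x) * r x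
      + 2 * slope x * slope_deriv x * r x
      + 2 * (1 - x) * slope x * slope_deriv x * (r x)\<^sup>2) (at x)"
    by (auto intro!: derivative_eq_intros DERIV_slope DERIV_slope_deriv x
        simp: eval_nat_numeral algebra_simps)
  then show ?thesis
    by (simp add: pressure_deriv_def[abs_def] pressure_deriv2_def r_def divide_inverse
        power_inverse)
qed

section \<open>Limits at the north pole\<close>

lemma eventually_interval: "eventually (\<lambda>x. x \<in> {a<..<1}) (at_left 1)"
  using eventually_at_left_real[OF a_bounds(2)] .

text \<open>By l'Hopital's rule, since numerator and denominator tend to 0 and the quotient of their
  derivatives is \<open>deriv U\<close>.\<close>

lemma tendsto_slope: "(slope \<longlongrightarrow> \<gamma>) (at_left 1)"
  unfolding slope_def[abs_def]
proof (rule lhopital_left)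
  show "eventually (\<lambda>x. (U has_real_derivative deriv U x) (at x)) (at_left 1)"
    using eventually_interval by eventually_elim (rule deriv_U)
  show "((\<lambda>x. deriv U x / 1) \<longlongrightarrow> \<gamma>) (at_left 1)" "(U \<longlongrightarrow> 0) (at_left 1)"
    using sol by (auto simp: north_solution_def)
  show "eventually (\<lambda>x. x - 1 \<noteq> 0) (at_left (1::real))"
    using eventually_interval by eventually_elim auto
  show "((\<lambda>x. x - 1) \<longlongrightarrow> 0) (at_left (1::real))"
    by (auto intro!: tendsto_eq_intros)
qed (auto intro!: always_eventually derivative_eq_intros)

lemma tendsto_slope_deriv: "(slope_deriv \<longlongrightarrow> (\<gamma>\<^sup>2 / 2 + \<gamma> - \<mu>) / 2) (at_left 1)"
  unfolding slope_deriv_def[abs_def] by (auto intro!: tendsto_eq_intros tendsto_slope)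

lemma tendsto_pressure: "(pressure U \<longlongrightarrow> \<gamma> - \<mu>) (at_left 1)"
proof (rule Lim_transform_eventually)
  show "((\<lambda>x. slope x + (x - 1) * slope_deriv x - \<mu> - (1 - x) * (slope x)\<^sup>2 / (2 * (1 + x)))
      \<longlongrightarrow> \<gamma> - \<mu>) (at_left 1)"
    by (auto intro!: tendsto_eq_intros tendsto_slope tendsto_slope_deriv)
  show "eventually (\<lambda>x. slope x + (x - 1) * slope_deriv x - \<mu>
      - (1 - x) * (slope x)\<^sup>2 / (2 * (1 + x)) = pressure U x) (at_left 1)"
    using eventually_interval by eventually_elim (simp add: pressure_eq_slope)
qed

lemma tendsto_pressure_deriv: "(pressure_deriv \<longlongrightarrow> 3/4 * \<gamma>\<^sup>2 + \<gamma> - \<mu>) (at_left 1)"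
  unfolding pressure_deriv_def[abs_def]
  by (auto intro!: tendsto_eq_intros tendsto_slope tendsto_slope_deriv)
     (simp add: field_simps)

text \<open>The condition \<open>p'(1) = 0\<close> eliminates \<mu>: then \<open>h'\<close> tends to
  \<open>- (\<gamma>\<^sup>2 / 8)\<close>, \<open>h''\<close> to \<open>- (\<gamma>^3 / 16)\<close>,
  and the terms carrying a factor \<open>1 - x\<close> vanish in the limit.\<close>

lemma tendsto_pressure_deriv2:
  assumes "3/4 * \<gamma>\<^sup>2 + \<gamma> - \<mu> = 0"
  shows "(pressure_deriv2 \<longlongrightarrow> - (5/16 * \<gamma>^3 + \<gamma>\<^sup>2 / 4)) (at_left 1)"
proof -
  have "(\<gamma>\<^sup>2 / 2 + \<gamma> - \<mu>) / 2 = - (\<gamma>\<^sup>2 / 8)" using assms by simp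
  with tendsto_slope_deriv have sd: "(slope_deriv \<longlongrightarrow> - (\<gamma>\<^sup>2 / 8)) (at_left 1)" by simp
  have r: "((\<lambda>x. inverse (1 + x)) \<longlongrightarrow> 1 / 2) (at_left (1::real))"
    by (auto intro!: tendsto_eq_intros)
  have sd2: "(slope_deriv2 \<longlongrightarrow> - (\<gamma>^3 / 16)) (at_left 1)"
    unfolding slope_deriv2_def[abs_def] divide_inverse
    by (rule tendsto_eq_rhs, (rule r tendsto_slope sd tendsto_intros)+)
       (simp add: eval_nat_numeral)
  show ?thesis
    unfolding pressure_deriv2_def[abs_def] divide_inverse power_inverse[symmetric]
    by (rule tendsto_eq_rhs, (rule r tendsto_slope sd sd2 tendsto_intros)+)
       (simp add: eval_nat_numeral field_simps)
qed

lemma tendsto_deriv_pressure: "(deriv (pressure U) \<longlongrightarrow> 3/4 * \<gamma>\<^sup>2 + \<gamma> - \<mu>) (at_left 1)"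
proof (rule Lim_transform_eventually[OF tendsto_pressure_deriv])
  show "eventually (\<lambda>x. pressure_deriv x = deriv (pressure U) x) (at_left 1)"
    using eventually_interval by eventually_elim (simp add: DERIV_imp_deriv[OF DERIV_pressure])
qed

section \<open>Sign of the pressure derivative near the pole\<close>

lemma eventually_left_interval:
  assumes "eventually P (at_left 1)"
  obtains c where "a \<le> c" "c < 1" "\<And>x. x \<in> {c<..<1} \<Longrightarrow> P x"
proof -
  obtain b where b: "b < 1" "\<And>y. b < y \<Longrightarrow> y < 1 \<Longrightarrow> P y"
    using assms eventually_at_left[of 0 "1::real"] by auto
  \<comment> \<open>The maximum keeps the interval inside the domain of the solution.\<close>
  show ?thesis using b a_bounds by (intro that[of "max a b"]) auto
qed

lemma eventually_pressure_deriv_pos: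
  assumes "\<gamma> > 0" "3/4 * \<gamma>\<^sup>2 + \<gamma> - \<mu> \<ge> 0"
  shows "eventually (\<lambda>x. pressure_deriv x > 0) (at_left 1)"
proof (cases "3/4 * \<gamma>\<^sup>2 + \<gamma> - \<mu> = 0")
  case False
  with assms show ?thesis
    by (intro order_tendstoD(1)[OF tendsto_pressure_deriv]) auto
next
  case True
  have "eventually (\<lambda>x. pressure_deriv2 x < 0) (at_left 1)"
  proof (rule order_tendstoD(2)[OF tendsto_pressure_deriv2[OF True]])
    have "5/16 * \<gamma>^3 + \<gamma>\<^sup>2 / 4 > 0"
      using assms(1) by (intro add_pos_pos) simp_all
    then show "- (5/16 * \<gamma>^3 + \<gamma>\<^sup>2 / 4) < 0" by linarith
  qed
  then obtain c where c: "a \<le> c" "c < 1" "\<And>x. x \<in> {c<..<1} \<Longrightarrow> pressure_deriv2 x < 0"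
    by (rule eventually_left_interval) blast
  have "pressure_deriv x > 0" if "x \<in> {c<..<1}" for x
  proof -
    \<comment> \<open>Since \<open>p'' < 0\<close>, the function \<open>- p'\<close> increases
      towards its limit 0 and so lies below it.\<close>
    have "- pressure_deriv x < 0"
    proof (rule less_left_limit[OF _ _ _ that])
      show "((\<lambda>x. - pressure_deriv x) has_real_derivative - pressure_deriv2 y) (at y)"
        if "y \<in> {c<..<1}" for y
        using that c by (intro DERIV_minus DERIV_pressure_deriv) auto
      show "((\<lambda>x. - pressure_deriv x) \<longlongrightarrow> 0) (at_left 1)"
        using tendsto_minus[OF tendsto_pressure_deriv] True by simp
    qed (use c in auto)
    then show ?thesis by simp
  qed
  then show ?thesis
    using eventually_at_left_real[OF c(2)] by (auto elim: eventually_mono)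
qed

lemma pressure_less_left:
  assumes "\<gamma> > 0" "3/4 * \<gamma>\<^sup>2 + \<gamma> - \<mu> \<ge> 0"
  shows "\<exists>\<delta>>0. a \<le> 1 - \<delta> \<and> (\<forall>x\<in>{1 - \<delta><..<1}. pressure U x < \<gamma> - \<mu>)"
proof -
  obtain c where c: "a \<le> c" "c < 1" "\<And>x. x \<in> {c<..<1} \<Longrightarrow> pressure_deriv x > 0"
    using eventually_pressure_deriv_pos[OF assms] by (rule eventually_left_interval) blast
  have "pressure U x < \<gamma> - \<mu>" if "x \<in> {c<..<1}" for x
    by (rule less_left_limit[OF _ c(3) tendsto_pressure that])
       (use c in \<open>auto intro: DERIV_pressure\<close>)
  with c show ?thesis by (intro exI[of _ "1 - c"]) auto
qed

end

section \<open>The parameter set and the case distinction\<close>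

lemma mem_I_p_iff:
  "(\<mu>, \<gamma>) \<in> I_p \<longleftrightarrow> \<gamma> > 0 \<and> 3/4 * \<gamma>\<^sup>2 + \<gamma> - \<mu> < 0"
proof -
  \<comment> \<open>The bound on the left is the larger root in \<gamma> of the quadratic on the
    right when the roots are real.\<close>
  have "\<gamma> < 2/3 * (sqrt (1 + 3 * \<mu>) - 1) \<longleftrightarrow> 3/4 * \<gamma>\<^sup>2 + \<gamma> - \<mu> < 0" if "\<gamma> > 0"
  proof -
    have "\<gamma> < 2/3 * (sqrt (1 + 3 * \<mu>) - 1) \<longleftrightarrow> 1 + 3/2 * \<gamma> < sqrt (1 + 3 * \<mu>)"
      by (simp add: field_simps)
    \<comment> \<open>Both sides become square roots, as \<open>1 + 3/2 * \<gamma>\<close> is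
      positive. In HOL \<open>sqrt\<close> is odd and strictly increasing on all reals, so comparing
      the arguments is also valid when \<open>1 + 3 * \<mu>\<close> is negative.\<close>
    also have "\<dots> \<longleftrightarrow> sqrt ((1 + 3/2 * \<gamma>)\<^sup>2) < sqrt (1 + 3 * \<mu>)"
      using that by (simp del: real_sqrt_less_iff)
    also have "\<dots> \<longleftrightarrow> (1 + 3/2 * \<gamma>)\<^sup>2 < 1 + 3 * \<mu>"
      by (rule real_sqrt_less_iff)
    also have "\<dots> \<longleftrightarrow> 3/4 * \<gamma>\<^sup>2 + \<gamma> - \<mu> < 0"
    proof -
      have eq: "3/4 * \<gamma>\<^sup>2 + \<gamma> - \<mu> = ((1 + 3/2 * \<gamma>)\<^sup>2 - (1 + 3 * \<mu>)) / 3"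
        by (simp add: power2_eq_square field_simps)
      show ?thesis unfolding eq by simp
    qed
    finally show ?thesis .
  qed
  moreover have "\<mu> > 0" if "\<gamma> > 0" "3/4 * \<gamma>\<^sup>2 + \<gamma> - \<mu> < 0"
    using that zero_le_power2[of \<gamma>] by linarith
  ultimately show ?thesis by (auto simp: I_p_def)
qed

theorem theorem6p1:
  fixes \<mu> \<gamma> a :: real and U :: "real \<Rightarrow> real"
  assumes "maximal_north_solution \<mu> \<gamma> a U"
  shows "((\<mu>, \<gamma>) \<in> I_p \<longrightarrow>
            (\<exists>v. (radial_velocity U \<longlongrightarrow> v) (at_left 1) \<and> v > 0) \<and>
            (\<exists>q. (deriv (pressure U) \<longlongrightarrow> q) (at_left 1) \<and> q < 0)) \<and>
         ((\<mu>, \<gamma>) \<notin> I_p \<longrightarrow>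
            (\<exists>v. (radial_velocity U \<longlongrightarrow> v) (at_left 1) \<and> v \<le> 0) \<or>
            (\<exists>p1. (pressure U \<longlongrightarrow> p1) (at_left 1) \<and>
               (\<exists>\<delta>>0. a \<le> 1 - \<delta> \<and> (\<forall>x\<in>{1 - \<delta><..<1}. pressure U x < p1))))"
proof -
  have sol: "north_solution \<mu> \<gamma> a U"
    using assms by (simp add: maximal_north_solution_def)
  then have vel: "(radial_velocity U \<longlongrightarrow> \<gamma>) (at_left 1)"
    by (simp add: radial_velocity_def north_solution_def)
  show ?thesis
  proof (intro conjI impI)
    assume "(\<mu>, \<gamma>) \<in> I_p"
    then have "\<gamma> > 0" "3/4 * \<gamma>\<^sup>2 + \<gamma> - \<mu> < 0" by (simp_all add: mem_I_p_iff)
    with vel tendsto_deriv_pressure[OF sol]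
    show "\<exists>v. (radial_velocity U \<longlongrightarrow> v) (at_left 1) \<and> v > 0"
      and "\<exists>q. (deriv (pressure U) \<longlongrightarrow> q) (at_left 1) \<and> q < 0"
      by blast+
  next
    assume *: "(\<mu>, \<gamma>) \<notin> I_p"
    show "(\<exists>v. (radial_velocity U \<longlongrightarrow> v) (at_left 1) \<and> v \<le> 0) \<or>
        (\<exists>p1. (pressure U \<longlongrightarrow> p1) (at_left 1) \<and>
           (\<exists>\<delta>>0. a \<le> 1 - \<delta> \<and> (\<forall>x\<in>{1 - \<delta><..<1}. pressure U x < p1)))"
    \<comment> \<open>The radial velocity tends to \<gamma>, so \<gamma> \<le> 0 gives the first
      alternative. Otherwise, being outside \<open>I_p\<close> means \<open>p'(1) \<ge> 0\<close>,
      which gives the second.\<close>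
    proof (cases "\<gamma> > 0")
      case True
      with * have "3/4 * \<gamma>\<^sup>2 + \<gamma> - \<mu> \<ge> 0" by (simp add: mem_I_p_iff)
      from tendsto_pressure[OF sol] pressure_less_left[OF sol True this] show ?thesis by blast
    next
      case False
      with vel show ?thesis by (meson not_less)
    qed
  qed
qed

end
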